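(* Let $k\ge1$ be an integer. Every vector field on $\Omega$ whose three components are polynomials in $(\xi,\eta,\zeta)$ of total degree at most $k-1$ belongs to $\mathcal U^{(2),k}(\Omega)$; that is, $(P^{k-1})^3\subset\mathcal U^{(2),k}(\Omega)$.
   Context: $\Omega=\{(\xi,\eta,\zeta)\in\mathbb R^3:\xi,\eta,\zeta\ge0,\ \xi\le1-\zeta,\ \eta\le1-\zeta\}$; $\Omega_\infty=\{(x,y,z):0\le x,y\le1,\ z\ge0\}$; $\phi:\Omega_\infty\to\Omega$, $\phi(x,y,z)=\left(\frac{x}{1+z},\frac{y}{1+z},\frac{z}{1+z}\right)$, a diffeomorphism onto $\Omega$ minus its apex $(0,0,1)$. For 2-forms (vector fields $v$) $\phi^*v=|D\phi|D\phi^{-1}(v\circ\phi)$, $|D\phi|$ the Jacobian determinant, and $(\phi^{-1})^*=(\phi^* )^{-1}$. $Q^{l,m,n}$: polynomials of degree at most $l,m,n$ in $x,y,z$; $Q^{l,m,n}_k=\{u/(1+z)^k:u\in Q^{l,m,n}\}$; $P^n_k[w,z]=\{u(w,z)/(1+z)^k:u$ polynomial of total degree $\le n\}$. Polynomial spaces with a negative degree are $\{0\}$. $\mathcal U^{(2),k}(\Omega_\infty)$ is the set of all $u\in Q_{k+2}^{k,k-1,k-2}\times Q_{k+2}^{k-1,k,k-2}\times Q_{k+2}^{k-1,k-1,k-1}\oplus\{\frac{z^{k-1}}{(1+z)^{k+2}}(0,2s,s_y(1+z))^T:s\in Q^{k-1,k}[x,y]\}\oplus\{\frac{z^{k-1}}{(1+z)^{k+2}}(2t,0,t_x(1+z))^T:t\in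 Q^{k,k-1}[x,y]\}$ whose normal components lie in $P^{k-1}_{k+2}[x,z]$ on the faces $y=0,1$ and in $P^{k-1}_{k+2}[y,z]$ on the faces $x=0,1$ (subscripts $x,y$ on $s,t$ are partial derivatives). $\mathcal U^{(2),k}(\Omega)=(\phi^{-1})^*\mathcal U^{(2),k}(\Omega_\infty)$. *)

theory Defs
  imports "HOL-Analysis.Analysis"
begin

definition Pyr :: "(real^3) set" where
  "Pyr = {q. 0 \<le> q$1 \<and> 0 \<le> q$2 \<and> 0 \<le> q$3 \<and> q$1 \<le> 1 - q$3 \<and> q$2 \<le> 1 - q$3}"

definition Pyr_inf :: "(real^3) set" where
  "Pyr_inf = {p. 0 \<le> p$1 \<and> p$1 \<le> 1 \<and> 0 \<le> p$2 \<and> p$2 \<le> 1 \<and> 0 \<le> p$3}"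

definition apex :: "real^3" where
  "apex = vector [0, 0, 1]"

definition phi :: "real^3 \<Rightarrow> real^3" where
  "phi p = vector [p$1 / (1 + p$3), p$2 / (1 + p$3), p$3 / (1 + p$3)]"

(* The vector fields on a set S are the elements of extensional S, so that two fields on S are
   equal iff they agree at the points of S. *)

definition pullback2 :: "(real^3) set \<Rightarrow> (real^3 \<Rightarrow> real^3) \<Rightarrow> (real^3 \<Rightarrow> real^3) \<Rightarrow> (real^3 \<Rightarrow> real^3)"
  where
  "pullback2 S f v = (\<lambda>p\<in>S. det (jacobian f (at p)) *\<^sub>R (matrix_inv (jacobian f (at p)) *v v (f p)))"

(* Polynomials are represented by the functions they induce. Degree bounds are integers: for a
   negative bound there is no admissible exponent, and the space is {0}. *)

definition Q2 :: "int \<Rightarrow> int \<Rightarrow> (real \<Rightarrow> real \<Rightarrow> real) set" where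
  "Q2 l m = {(\<lambda>x y. \<Sum>(a, b) \<in> {(a, b). int a \<le> l \<and> int b \<le> m}. c a b * x^a * y^b) | c. True}"

definition Q3 :: "int \<Rightarrow> int \<Rightarrow> int \<Rightarrow> (real \<Rightarrow> real \<Rightarrow> real \<Rightarrow> real) set" where
  "Q3 l m n = {(\<lambda>x y z. \<Sum>(a, b, d) \<in> {(a, b, d). int a \<le> l \<and> int b \<le> m \<and> int d \<le> n}.
      c a b d * x^a * y^b * z^d) | c. True}"

definition P2 :: "int \<Rightarrow> (real \<Rightarrow> real \<Rightarrow> real) set" where
  "P2 n = {(\<lambda>x y. \<Sum>(a, b) \<in> {(a, b). int (a + b) \<le> n}. c a b * x^a * y^b) | c. True}"

definition P3 :: "int \<Rightarrow> (real \<Rightarrow> real \<Rightarrow> real \<Rightarrow> real) set" where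
  "P3 n = {(\<lambda>x y z. \<Sum>(a, b, d) \<in> {(a, b, d). int (a + b + d) \<le> n}.
      c a b d * x^a * y^b * z^d) | c. True}"

definition Q3w :: "int \<Rightarrow> int \<Rightarrow> int \<Rightarrow> nat \<Rightarrow> (real \<Rightarrow> real \<Rightarrow> real \<Rightarrow> real) set" where
  "Q3w l m n k = {(\<lambda>x y z. u x y z / (1 + z)^k) | u. u \<in> Q3 l m n}"

definition P2w :: "int \<Rightarrow> nat \<Rightarrow> (real \<Rightarrow> real \<Rightarrow> real) set" where
  "P2w n k = {(\<lambda>w z. u w z / (1 + z)^k) | u. u \<in> P2 n}"

definition U2_base :: "nat \<Rightarrow> (real \<Rightarrow> real \<Rightarrow> real \<Rightarrow> real^3) set" where
  "U2_base k = {(\<lambda>x y z. vector [u1 x y z, u2 x y z, u3 x y z]) | u1 u2 u3.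
      u1 \<in> Q3w (int k) (int k - 1) (int k - 2) (k + 2) \<and>
      u2 \<in> Q3w (int k - 1) (int k) (int k - 2) (k + 2) \<and>
      u3 \<in> Q3w (int k - 1) (int k - 1) (int k - 1) (k + 2)}"

definition U2_s :: "nat \<Rightarrow> (real \<Rightarrow> real \<Rightarrow> real \<Rightarrow> real^3) set" where
  "U2_s k = {(\<lambda>x y z. (z^(k - 1) / (1 + z)^(k + 2)) *\<^sub>R
      vector [0, 2 * s x y, deriv (\<lambda>y'. s x y') y * (1 + z)]) | s. s \<in> Q2 (int k - 1) (int k)}"

definition U2_t :: "nat \<Rightarrow> (real \<Rightarrow> real \<Rightarrow> real \<Rightarrow> real^3) set" where
  "U2_t k = {(\<lambda>x y z. (z^(k - 1) / (1 + z)^(k + 2)) *\<^sub>R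
      vector [2 * t x y, 0, deriv (\<lambda>x'. t x' y) x * (1 + z)]) | t. t \<in> Q2 (int k) (int k - 1)}"

(* On the faces y = 0, 1 (x = 0, 1) the normal component is the second (first) component up to
   sign, and the spaces P2w are closed under negation. The
   sum f + g + h is direct: the first two components of f contain no z^(k - 1) in the numerator,
   which is the only power of z occurring in those of g and h. *)

definition U2_inf :: "nat \<Rightarrow> (real^3 \<Rightarrow> real^3) set" where
  "U2_inf k = {u \<in> extensional Pyr_inf.
      (\<exists>f\<in>U2_base k. \<exists>g\<in>U2_s k. \<exists>h\<in>U2_t k. \<forall>p\<in>Pyr_inf.
         u p = f (p$1) (p$2) (p$3) + g (p$1) (p$2) (p$3) + h (p$1) (p$2) (p$3)) \<and>
      (\<forall>j\<in>{0, 1}. \<exists>r\<in>P2w (int k - 1) (k + 2). \<forall>x\<in>{0..1}. \<forall>z\<ge>0.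
         u (vector [x, j, z]) $ 2 = r x z) \<and>
      (\<forall>j\<in>{0, 1}. \<exists>r\<in>P2w (int k - 1) (k + 2). \<forall>y\<in>{0..1}. \<forall>z\<ge>0.
         u (vector [j, y, z]) $ 1 = r y z)}"

(* Since phi maps onto Pyr without its apex, the fields in U2 k live there;
   pullback2_phi_bij below shows that the inverse is the one of a bijection. *)

definition U2 :: "nat \<Rightarrow> (real^3 \<Rightarrow> real^3) set" where
  "U2 k = inv_into (extensional (Pyr - {apex})) (pullback2 Pyr_inf phi) ` U2_inf k"

lemma phi_image: "phi ` Pyr_inf = Pyr - {apex}"
proof (intro equalityI subsetI)
  fix q assume "q \<in> phi ` Pyr_inf"
  then obtain p where p: "p \<in> Pyr_inf" "q = phi p" by blast
  have z: "1 + p$3 > 0" using p by (simp add: Pyr_inf_def)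
  have q: "q$1 = p$1 / (1 + p$3)" "q$2 = p$2 / (1 + p$3)" "q$3 = p$3 / (1 + p$3)"
    using p by (simp_all add: phi_def)
  have e: "1 - q$3 = 1 / (1 + p$3)" using z by (simp add: q field_simps)
  then have "q$3 \<noteq> 1" using z by auto
  then have "q \<noteq> apex" by (auto simp: apex_def)
  moreover have "q \<in> Pyr" using p z
    unfolding Pyr_def Pyr_inf_def mem_Collect_eq e unfolding q by (simp add: divide_right_mono)
  ultimately show "q \<in> Pyr - {apex}" by blast
next
  fix q assume q: "q \<in> Pyr - {apex}"
  have z: "q$3 < 1"
  proof (rule ccontr)
    assume "\<not> q$3 < 1"
    then have "q$1 = 0" "q$2 = 0" "q$3 = 1" using q by (auto simp: Pyr_def)
    then show False using q by (simp add: apex_def vec_eq_iff forall_3)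
  qed
  define p :: "real^3" where "p = vector [q$1 / (1 - q$3), q$2 / (1 - q$3), q$3 / (1 - q$3)]"
  have "1 + q$3 / (1 - q$3) = 1 / (1 - q$3)" using z by (simp add: field_simps)
  then have "phi p = q" using z by (simp add: phi_def p_def vec_eq_iff forall_3)
  moreover have "p \<in> Pyr_inf" using q z by (auto simp: Pyr_inf_def Pyr_def p_def)
  ultimately show "q \<in> phi ` Pyr_inf" by blast
qed

lemma phi_inj: "inj_on phi Pyr_inf"
proof (rule inj_onI)
  fix p q assume pq: "p \<in> Pyr_inf" "q \<in> Pyr_inf" and e: "phi p = phi q"
  have z: "1 + p$3 > 0" "1 + q$3 > 0" using pq by (auto simp: Pyr_inf_def)
  have 1: "p$1 / (1 + p$3) = q$1 / (1 + q$3)" "p$2 / (1 + p$3) = q$2 / (1 + q$3)"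
      "p$3 / (1 + p$3) = q$3 / (1 + q$3)"
    using e by (auto simp: phi_def vec_eq_iff forall_3)
  then have 3: "p$3 = q$3" using z by (simp add: field_simps)
  with 1 z show "p = q" by (simp add: vec_eq_iff forall_3)
qed

lemma phi_has_derivative:
  assumes "1 + p$3 \<noteq> 0"
  shows "(phi has_derivative (\<lambda>h. vector
    [h$1 / (1 + p$3) - p$1 * h$3 / (1 + p$3)^2,
     h$2 / (1 + p$3) - p$2 * h$3 / (1 + p$3)^2,
     h$3 / (1 + p$3)^2])) (at p)"
proof (subst has_derivative_componentwise_within, rule ballI)
  fix i :: "real^3" assume "i \<in> Basis"
  then obtain j where j: "i = axis j 1" by (auto simp: Basis_vec_def)
  have c: "((\<lambda>p. p$m) has_derivative (\<lambda>h. h$m)) (at p)" for m :: 3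
    by (rule bounded_linear_imp_has_derivative) (rule bounded_linear_vec_nth)
  have m: "((\<lambda>p. p$m / (1 + p$3)) has_derivative
      (\<lambda>h. h$m / (1 + p$3) - p$m * h$3 / (1 + p$3)^2)) (at p)" for m :: 3
    by (rule has_derivative_eq_rhs, (rule derivative_intros c assms)+)
       (simp add: fun_eq_iff divide_inverse power2_eq_square)
  have m3: "h / (1 + p$3) - p$3 * h / (1 + p$3)^2 = h / (1 + p$3)^2" for h
    using assms by (simp add: divide_simps power2_eq_square) (simp add: algebra_simps)
  have "\<forall>j::3. ((\<lambda>p. phi p $ j) has_derivative (\<lambda>h. vector
    [h$1 / (1 + p$3) - p$1 * h$3 / (1 + p$3)^2,
     h$2 / (1 + p$3) - p$2 * h$3 / (1 + p$3)^2,
     h$3 / (1 + p$3)^2] $ j)) (at p)"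
    unfolding forall_3 phi_def vector_3 using m[of 1] m[of 2] m[of 3] unfolding m3 by simp
  then show "((\<lambda>x. phi x \<bullet> i) has_derivative (\<lambda>h. vector
    [h$1 / (1 + p$3) - p$1 * h$3 / (1 + p$3)^2,
     h$2 / (1 + p$3) - p$2 * h$3 / (1 + p$3)^2,
     h$3 / (1 + p$3)^2] \<bullet> i)) (at p)"
    by (simp add: j inner_axis)
qed

lemma det_jacobian_phi:
  assumes "1 + p$3 \<noteq> 0"
  shows "det (jacobian phi (at p)) = 1 / (1 + p$3)^4"
proof -
  have "jacobian phi (at p) = matrix (\<lambda>h. vector
    [h$1 / (1 + p$3) - p$1 * h$3 / (1 + p$3)^2,
     h$2 / (1 + p$3) - p$2 * h$3 / (1 + p$3)^2,
     h$3 / (1 + p$3)^2])"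
    unfolding jacobian_def using frechet_derivative_at[OF phi_has_derivative[OF assms]] by simp
  then show ?thesis using assms
    by (simp add: det_3 matrix_def axis_def power2_eq_square power4_eq_xxxx)
qed

lemma pullback2_phi_bij:
  "bij_betw (pullback2 Pyr_inf phi) (extensional (Pyr - {apex})) (extensional Pyr_inf)"
proof (rule bij_betw_byWitness)
  define J where "J p = jacobian phi (at p)" for p
  define g where "g = inv_into Pyr_inf phi"
  define pf where
    "pf u = (\<lambda>q\<in>Pyr - {apex}. (1 / det (J (g q))) *\<^sub>R (J (g q) *v u (g q)))" for u :: "real^3 \<Rightarrow> real^3"
  have d: "det (J p) \<noteq> 0" if "p \<in> Pyr_inf" for p
  proof -
    have "1 + p$3 \<noteq> 0" using that by (simp add: Pyr_inf_def)
    then show ?thesis by (simp add: J_def det_jacobian_phi)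
  qed
  have inv: "J p ** matrix_inv (J p) = mat 1 \<and> matrix_inv (J p) ** J p = mat 1"
    if "p \<in> Pyr_inf" for p
    using d[OF that] unfolding invertible_det_nz[symmetric] invertible_def matrix_inv_def
    by (rule someI_ex)
  have g: "g q \<in> Pyr_inf" "phi (g q) = q" if "q \<in> Pyr - {apex}" for q
    using that unfolding g_def
    by (simp_all add: inv_into_into f_inv_into_f flip: phi_image)
  have g': "g (phi p) = p" "phi p \<in> Pyr - {apex}" if "p \<in> Pyr_inf" for p
    using that phi_inj phi_image unfolding g_def by auto
  show "\<forall>v\<in>extensional (Pyr - {apex}). pf (pullback2 Pyr_inf phi v) = v"
  proof
    fix v :: "real^3 \<Rightarrow> real^3" assume v: "v \<in> extensional (Pyr - {apex})"
    show "pf (pullback2 Pyr_inf phi v) = v"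
    proof (rule extensionalityI[OF _ v])
      show "pf (pullback2 Pyr_inf phi v) \<in> extensional (Pyr - {apex})" by (simp add: pf_def)
      fix q assume "q \<in> Pyr - {apex}"
      then show "pf (pullback2 Pyr_inf phi v) q = v q"
        using g[of q] d[of "g q"] inv[of "g q"]
        by (simp add: pf_def pullback2_def J_def[symmetric] matrix_vector_mul_assoc
            matrix_vector_mult_scaleR)
    qed
  qed
  show "\<forall>u\<in>extensional Pyr_inf. pullback2 Pyr_inf phi (pf u) = u"
  proof
    fix u :: "real^3 \<Rightarrow> real^3" assume u: "u \<in> extensional Pyr_inf"
    show "pullback2 Pyr_inf phi (pf u) = u"
    proof (rule extensionalityI[OF _ u])
      show "pullback2 Pyr_inf phi (pf u) \<in> extensional Pyr_inf" by (simp add: pullback2_def)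
      fix p assume "p \<in> Pyr_inf"
      then show "pullback2 Pyr_inf phi (pf u) p = u p"
        using g'[of p] d[of p] inv[of p]
        by (simp add: pf_def pullback2_def J_def[symmetric] matrix_vector_mul_assoc
            matrix_vector_mult_scaleR)
    qed
  qed
  show "pullback2 Pyr_inf phi ` extensional (Pyr - {apex}) \<subseteq> extensional Pyr_inf"
    by (auto simp: pullback2_def)
  show "pf ` extensional Pyr_inf \<subseteq> extensional (Pyr - {apex})"
    by (auto simp: pf_def)
qed

end

theory Submission
  imports Defs
begin

text \<open>The Piola pullback of \<open>v\<close> along \<open>phi\<close> is
  \<open>((v1 + x v3) / (1+z)^3, (v2 + y v3) / (1+z)^3, v3 / (1+z)^2)\<close>, and composing a polynomial of
  total degree at most \<open>k-1\<close> with \<open>phi\<close> gives \<open>p / (1+z)^(k-1)\<close> where \<open>p\<close> again has total degree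
  at most \<open>k-1\<close>. So \<open>z^(k-1)\<close> occurs in \<open>p\<close> only with a constant coefficient \<open>\<alpha>\<close>. The surplus terms
  \<open>(\<alpha>1 + \<alpha>3 x) z^(k-1)\<close> and \<open>(\<alpha>2 + \<alpha>3 y) z^(k-1)\<close> are \<open>2t\<close> and \<open>2s\<close>, and
  \<open>s_y + t_x = \<alpha>3\<close> then also removes the surplus \<open>\<alpha>3 z^(k-1) (1+z)\<close> of the third component.\<close>

section \<open>Finite sums of monomials as elements of the polynomial spaces\<close>

text \<open>Coefficients of terms with the same exponent add up. Since \<open>c'\<close> is chosen
  before \<open>M\<close>, one coefficient family serves all evaluation points at once, as equality
  of polynomial functions requires.\<close>

lemma sum_collect:
  fixes c :: "'s \<Rightarrow> real" and e :: "'s \<Rightarrow> 'i"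
  assumes "finite S" "finite I" "\<And>s. s \<in> S \<Longrightarrow> e s \<in> I"
  shows "\<exists>c'. \<forall>M. (\<Sum>s\<in>S. c s * M (e s)) = (\<Sum>i\<in>I. c' i * M i)"
proof (intro exI allI)
  fix M :: "'i \<Rightarrow> real"
  have "(\<Sum>s\<in>S. c s * M (e s)) = (\<Sum>i\<in>I. \<Sum>s\<in>{s\<in>S. e s = i}. c s * M (e s))"
    using assms by (intro sum.group[symmetric]) auto
  also have "\<dots> = (\<Sum>i\<in>I. (\<Sum>s\<in>{s\<in>S. e s = i}. c s) * M i)"
    by (intro sum.cong refl) (simp add: sum_distrib_right)
  finally show "(\<Sum>s\<in>S. c s * M (e s)) = (\<Sum>i\<in>I. (\<Sum>s\<in>{s\<in>S. e s = i}. c s) * M i)" .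
qed

lemma finite_Q2_exponents: "finite {(a, b). int a \<le> l \<and> int b \<le> m}"
  by (rule finite_subset[of _ "{..nat l} \<times> {..nat m}"]) auto

lemma finite_Q3_exponents: "finite {(a, b, d). int a \<le> l \<and> int b \<le> m \<and> int d \<le> n}"
  by (rule finite_subset[of _ "{..nat l} \<times> {..nat m} \<times> {..nat n}"]) auto

lemma finite_P2_exponents: "finite {(a, b). int (a + b) \<le> n}"
  by (rule finite_subset[of _ "{..nat n} \<times> {..nat n}"]) auto

lemma finite_P3_exponents: "finite {(a, b, d). int (a + b + d) \<le> n}"
  by (rule finite_subset[of _ "{..nat n} \<times> {..nat n} \<times> {..nat n}"]) auto

text \<open>Here and in the three analogues below, the index set \<open>S\<close> is arbitrary and
  exponents may repeat, so products and expansions can be entered as they arise, without first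
  collecting like terms.\<close>

lemma Q2_sumI:
  assumes "finite S" "\<And>s. s \<in> S \<Longrightarrow> int (a s) \<le> l \<and> int (b s) \<le> m"
    and f: "\<And>x y. f x y = (\<Sum>s\<in>S. c s * x ^ a s * y ^ b s)"
  shows "f \<in> Q2 l m"
proof -
  obtain c' where c': "\<And>M. (\<Sum>s\<in>S. c s * M (a s, b s)) =
      (\<Sum>i\<in>{(a, b). int a \<le> l \<and> int b \<le> m}. c' i * M i)"
    using sum_collect[OF assms(1) finite_Q2_exponents[of l m], of "\<lambda>s. (a s, b s)" c] assms(2)
    by auto
  have "f x y = (\<Sum>(a, b)\<in>{(a, b). int a \<le> l \<and> int b \<le> m}. c' (a, b) * x ^ a * y ^ b)" for x y
    using c'[of "\<lambda>(a, b). x ^ a * y ^ b"] by (simp add: f case_prod_beta mult.assoc)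
  then show ?thesis unfolding Q2_def mem_Collect_eq
    by (intro exI[of _ "\<lambda>a b. c' (a, b)"] conjI TrueI ext) simp
qed

lemma P2_sumI:
  assumes "finite S" "\<And>s. s \<in> S \<Longrightarrow> int (a s + b s) \<le> n"
    and f: "\<And>x y. f x y = (\<Sum>s\<in>S. c s * x ^ a s * y ^ b s)"
  shows "f \<in> P2 n"
proof -
  obtain c' where c': "\<And>M. (\<Sum>s\<in>S. c s * M (a s, b s)) =
      (\<Sum>i\<in>{(a, b). int (a + b) \<le> n}. c' i * M i)"
    using sum_collect[OF assms(1) finite_P2_exponents[of n], of "\<lambda>s. (a s, b s)" c] assms(2)
    by auto
  have "f x y = (\<Sum>(a, b)\<in>{(a, b). int (a + b) \<le> n}. c' (a, b) * x ^ a * y ^ b)" for x y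
    using c'[of "\<lambda>(a, b). x ^ a * y ^ b"] by (simp add: f case_prod_beta mult.assoc)
  then show ?thesis unfolding P2_def mem_Collect_eq
    by (intro exI[of _ "\<lambda>a b. c' (a, b)"] conjI TrueI ext) simp
qed

lemma Q3_sumI:
  assumes "finite S" "\<And>s. s \<in> S \<Longrightarrow> int (a s) \<le> l \<and> int (b s) \<le> m \<and> int (d s) \<le> n"
    and f: "\<And>x y z. f x y z = (\<Sum>s\<in>S. c s * x ^ a s * y ^ b s * z ^ d s)"
  shows "f \<in> Q3 l m n"
proof -
  let ?I = "{(a, b, d). int a \<le> l \<and> int b \<le> m \<and> int d \<le> n}"
  obtain c' where c': "\<And>M. (\<Sum>s\<in>S. c s * M (a s, b s, d s)) = (\<Sum>i\<in>?I. c' i * M i)"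
    using sum_collect[OF assms(1) finite_Q3_exponents[of l m n], of "\<lambda>s. (a s, b s, d s)" c] assms(2)
    by auto
  have "f x y z = (\<Sum>(a, b, d)\<in>?I. c' (a, b, d) * x ^ a * y ^ b * z ^ d)" for x y z
    using c'[of "\<lambda>(a, b, d). x ^ a * y ^ b * z ^ d"] by (simp add: f case_prod_beta mult.assoc)
  then show ?thesis unfolding Q3_def mem_Collect_eq
    by (intro exI[of _ "\<lambda>a b d. c' (a, b, d)"] conjI TrueI ext) simp
qed

lemma P3_sumI:
  assumes "finite S" "\<And>s. s \<in> S \<Longrightarrow> int (a s + b s + d s) \<le> n"
    and f: "\<And>x y z. f x y z = (\<Sum>s\<in>S. c s * x ^ a s * y ^ b s * z ^ d s)"
  shows "f \<in> P3 n"
proof -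
  let ?I = "{(a, b, d). int (a + b + d) \<le> n}"
  obtain c' where c': "\<And>M. (\<Sum>s\<in>S. c s * M (a s, b s, d s)) = (\<Sum>i\<in>?I. c' i * M i)"
    using sum_collect[OF assms(1) finite_P3_exponents[of n], of "\<lambda>s. (a s, b s, d s)" c] assms(2)
    by auto
  have "f x y z = (\<Sum>(a, b, d)\<in>?I. c' (a, b, d) * x ^ a * y ^ b * z ^ d)" for x y z
    using c'[of "\<lambda>(a, b, d). x ^ a * y ^ b * z ^ d"] by (simp add: f case_prod_beta mult.assoc)
  then show ?thesis unfolding P3_def mem_Collect_eq
    by (intro exI[of _ "\<lambda>a b d. c' (a, b, d)"] conjI TrueI ext) simp
qed

lemma Q3_add:
  assumes "f \<in> Q3 l m n" "g \<in> Q3 l m n"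
  shows "(\<lambda>x y z. f x y z + g x y z) \<in> Q3 l m n"
proof -
  let ?I = "{(a, b, d). int a \<le> l \<and> int b \<le> m \<and> int d \<le> n}"
  obtain c c' where "f = (\<lambda>x y z. \<Sum>(a, b, d)\<in>?I. c a b d * x ^ a * y ^ b * z ^ d)"
    "g = (\<lambda>x y z. \<Sum>(a, b, d)\<in>?I. c' a b d * x ^ a * y ^ b * z ^ d)"
    using assms unfolding Q3_def by blast
  then have "(\<lambda>x y z. f x y z + g x y z) =
      (\<lambda>x y z. \<Sum>(a, b, d)\<in>?I. (c a b d + c' a b d) * x ^ a * y ^ b * z ^ d)"
    by (simp add: fun_eq_iff case_prod_beta distrib_right flip: sum.distrib)
  then show ?thesis unfolding Q3_def by (auto intro!: exI[of _ "\<lambda>a b d. c a b d + c' a b d"])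
qed

lemma P2_add:
  assumes "f \<in> P2 n" "g \<in> P2 n"
  shows "(\<lambda>x y. f x y + g x y) \<in> P2 n"
proof -
  let ?I = "{(a, b). int (a + b) \<le> n}"
  obtain c c' where "f = (\<lambda>x y. \<Sum>(a, b)\<in>?I. c a b * x ^ a * y ^ b)"
    "g = (\<lambda>x y. \<Sum>(a, b)\<in>?I. c' a b * x ^ a * y ^ b)"
    using assms unfolding P2_def by blast
  then have "(\<lambda>x y. f x y + g x y) = (\<lambda>x y. \<Sum>(a, b)\<in>?I. (c a b + c' a b) * x ^ a * y ^ b)"
    by (simp add: fun_eq_iff case_prod_beta distrib_right flip: sum.distrib)
  then show ?thesis unfolding P2_def by (auto intro!: exI[of _ "\<lambda>a b. c a b + c' a b"])
qed

section \<open>Polynomials of bounded total degree: restriction to faces, composition with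
  \<open>phi\<close>, top power of z\<close>

lemma P3_slices:
  assumes "p \<in> P3 n"
  shows "(\<lambda>w z. r * p w j z) \<in> P2 n" "(\<lambda>w z. r * p j w z) \<in> P2 n"
proof -
  let ?I = "{(a, b, d). int (a + b + d) \<le> n}"
  obtain c where p: "p = (\<lambda>x y z. \<Sum>(a, b, d)\<in>?I. c a b d * x ^ a * y ^ b * z ^ d)"
    using assms unfolding P3_def by blast
  show "(\<lambda>w z. r * p w j z) \<in> P2 n"
    by (rule P2_sumI[where S = ?I and a = "\<lambda>(a, b, d). a" and b = "\<lambda>(a, b, d). d"
          and c = "\<lambda>(a, b, d). r * c a b d * j ^ b"])
       (use finite_P3_exponents in \<open>auto simp: p case_prod_beta sum_distrib_left mult_ac\<close>)
  show "(\<lambda>w z. r * p j w z) \<in> P2 n"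
    by (rule P2_sumI[where S = ?I and a = "\<lambda>(a, b, d). b" and b = "\<lambda>(a, b, d). d"
          and c = "\<lambda>(a, b, d). r * c a b d * j ^ a"])
       (use finite_P3_exponents in \<open>auto simp: p case_prod_beta sum_distrib_left mult_ac\<close>)
qed

text \<open>Over the common denominator \<open>(1 + z) ^ n\<close>, a monomial of degree a + b + d
  acquires the factor \<open>(1 + z) ^ (n - (a + b + d))\<close>. Its binomial expansion only adds
  powers of z, by at most the missing degree, so the total degree stays at most n.\<close>

lemma P3_projective:
  assumes "f \<in> P3 (int n)"
  shows "\<exists>p\<in>P3 (int n). \<forall>x y z. 1 + z \<noteq> 0 \<longrightarrow>
    f (x / (1 + z)) (y / (1 + z)) (z / (1 + z)) = p x y z / (1 + z) ^ n"
proof -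
  let ?I = "{(a, b, d). int (a + b + d) \<le> int n}"
  let ?S = "Sigma ?I (\<lambda>(a, b, d). {..n - (a + b + d)})"
  obtain c where f: "f = (\<lambda>x y z. \<Sum>(a, b, d)\<in>?I. c a b d * x ^ a * y ^ b * z ^ d)"
    using assms unfolding P3_def by blast
  have fin: "finite ?I" by (rule finite_P3_exponents)
  define p where "p = (\<lambda>x y z. \<Sum>(a, b, d)\<in>?I. c a b d * x ^ a * y ^ b * z ^ d * (1 + z) ^ (n - (a + b + d)))"
  have "p x y z = (\<Sum>((a, b, d), i)\<in>?S. c a b d * real ((n - (a + b + d)) choose i) * x ^ a * y ^ b * z ^ (d + i))"
    for x y z
  proof -
    have "p x y z = (\<Sum>i\<in>?I. \<Sum>j\<in>(case i of (a, b, d) \<Rightarrow> {..n - (a + b + d)}). case i of (a, b, d) \<Rightarrow>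
        c a b d * real ((n - (a + b + d)) choose j) * x ^ a * y ^ b * z ^ (d + j))"
      unfolding p_def
      by (intro sum.cong refl)
         (auto simp: add.commute[of 1 z] binomial_ring sum_distrib_left power_add mult_ac)
    also have "\<dots> = (\<Sum>((a, b, d), i)\<in>?S. c a b d * real ((n - (a + b + d)) choose i) * x ^ a * y ^ b * z ^ (d + i))"
      using fin by (subst sum.Sigma) (auto simp: case_prod_beta)
    finally show ?thesis .
  qed
  then have "p \<in> P3 (int n)"
    by (intro P3_sumI[where S = ?S and a = "\<lambda>((a, b, d), i). a" and b = "\<lambda>((a, b, d), i). b"
          and d = "\<lambda>((a, b, d), i). d + i"
          and c = "\<lambda>((a, b, d), i). c a b d * real ((n - (a + b + d)) choose i)"])
       (use fin in \<open>auto simp: case_prod_beta intro!: finite_SigmaI\<close>)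
  moreover have "f (x / (1 + z)) (y / (1 + z)) (z / (1 + z)) = p x y z / (1 + z) ^ n"
    if z: "1 + z \<noteq> 0" for x y z
  proof -
    have "c a b d * (x / (1 + z)) ^ a * (y / (1 + z)) ^ b * (z / (1 + z)) ^ d =
        c a b d * x ^ a * y ^ b * z ^ d * (1 + z) ^ (n - (a + b + d)) / (1 + z) ^ n"
      if "a + b + d \<le> n" for a b d
    proof -
      \<comment> \<open>The bound a + b + d \<le> n keeps the natural-number subtraction from
        truncating.\<close>
      have "(1 + z) ^ n = (1 + z) ^ a * (1 + z) ^ b * (1 + z) ^ d * (1 + z) ^ (n - (a + b + d))"
        using that by (simp flip: power_add)
      then show ?thesis using z by (simp add: power_divide)
    qed
    then show ?thesis
      unfolding f p_def sum_divide_distrib by (intro sum.cong refl) auto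
  qed
  ultimately show ?thesis by blast
qed

text \<open>Total degree n leaves \<open>(0, 0, n)\<close> as the only exponent containing
  \<open>z ^ n\<close>; all others have z-degree at most n - 1. With k = n + 1, the spaces listed
  for q and its multiples are those required of the numerators in \<open>U2_base\<close>.\<close>

lemma P3_split_top_z:
  assumes "p \<in> P3 (int n)"
  obtains q \<alpha> where "\<And>x y z. p x y z = q x y z + \<alpha> * z ^ n"
    "q \<in> Q3 (int n + 1) (int n) (int n - 1)"
    "q \<in> Q3 (int n) (int n + 1) (int n - 1)"
    "(\<lambda>x y z. x * q x y z) \<in> Q3 (int n + 1) (int n) (int n - 1)"
    "(\<lambda>x y z. y * q x y z) \<in> Q3 (int n) (int n + 1) (int n - 1)"
    "(\<lambda>x y z. (1 + z) * q x y z) \<in> Q3 (int n) (int n) (int n)"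
proof -
  let ?I = "{(a, b, d). int (a + b + d) \<le> int n}"
  let ?S = "?I - {(0, 0, n)}"
  obtain c where p: "p = (\<lambda>x y z. \<Sum>(a, b, d)\<in>?I. c a b d * x ^ a * y ^ b * z ^ d)"
    using assms unfolding P3_def by blast
  have I: "finite ?I" by (rule finite_P3_exponents)
  then have S: "finite ?S" by blast
  define q where "q = (\<lambda>x y z. \<Sum>(a, b, d)\<in>?S. c a b d * x ^ a * y ^ b * z ^ d)"
  \<comment> \<open>Multiplication by a monomial shifts the exponents, so this one claim yields all
    the memberships. For n = 0 the set \<open>?S\<close> is empty and q = 0, in accordance with the
    negative z-degree bound.\<close>
  have monom: "(\<lambda>x y z. x ^ a' * y ^ b' * z ^ d' * q x y z) \<in> Q3 l m r"
    if "int n + int a' \<le> l" "int n + int b' \<le> m" "int n - 1 + int d' \<le> r" for a' b' d' l m r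
    by (rule Q3_sumI[OF S, where a = "\<lambda>(a, b, d). a + a'" and b = "\<lambda>(a, b, d). b + b'"
          and d = "\<lambda>(a, b, d). d + d'" and c = "\<lambda>(a, b, d). c a b d"])
       (use that in \<open>auto simp: q_def case_prod_beta sum_distrib_left power_add mult_ac\<close>)
  show ?thesis
  proof
    show "p x y z = q x y z + c 0 0 n * z ^ n" for x y z
      unfolding p q_def by (subst sum.remove[OF I, of "(0, 0, n)"]) auto
    show "q \<in> Q3 (int n + 1) (int n) (int n - 1)" using monom[of 0 _ 0 _ 0] by simp
    show "q \<in> Q3 (int n) (int n + 1) (int n - 1)" using monom[of 0 _ 0 _ 0] by simp
    show "(\<lambda>x y z. x * q x y z) \<in> Q3 (int n + 1) (int n) (int n - 1)"
      using monom[of 1 _ 0 _ 0] by simp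
    show "(\<lambda>x y z. y * q x y z) \<in> Q3 (int n) (int n + 1) (int n - 1)"
      using monom[of 0 _ 1 _ 0] by simp
    have "(\<lambda>x y z. q x y z + z * q x y z) \<in> Q3 (int n) (int n) (int n)"
      using monom[of 0 _ 0 _ 0] monom[of 0 _ 0 _ 1] by (intro Q3_add) simp_all
    then show "(\<lambda>x y z. (1 + z) * q x y z) \<in> Q3 (int n) (int n) (int n)"
      by (simp add: algebra_simps)
  qed
qed

lemma P2wI: "u \<in> P2 n \<Longrightarrow> (\<lambda>w z. u w z / (1 + z) ^ k) \<in> P2w n k"
  unfolding P2w_def by blast

section \<open>The pullback along \<open>phi\<close> in coordinates\<close>

lemma pullback2_phi:
  assumes "p \<in> Pyr_inf"
  shows "pullback2 Pyr_inf phi v p = vector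
    [(v (phi p) $ 1 + p$1 * v (phi p) $ 3) / (1 + p$3) ^ 3,
     (v (phi p) $ 2 + p$2 * v (phi p) $ 3) / (1 + p$3) ^ 3,
     v (phi p) $ 3 / (1 + p$3) ^ 2]"
proof -
  define J where "J = jacobian phi (at p)"
  define w where "w = v (phi p)"
  \<comment> \<open>Candidate for the inverse Jacobian applied to w: the third row of
    \<open>J *v h = w\<close> determines \<open>h$3\<close>, and the other two rows then give
    \<open>h$1\<close> and \<open>h$2\<close>. Checking \<open>J *v h = w\<close> avoids computing
    the inverse matrix.\<close>
  define h :: "real^3" where "h = vector [(1 + p$3) * (w$1 + p$1 * w$3),
    (1 + p$3) * (w$2 + p$2 * w$3), (1 + p$3) ^ 2 * w$3]"
  have z: "1 + p$3 \<noteq> 0" using assms by (simp add: Pyr_inf_def)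
  note D = phi_has_derivative[OF z]
  have det: "det J = 1 / (1 + p$3) ^ 4" unfolding J_def by (rule det_jacobian_phi[OF z])
  have "J *v h = w"
    unfolding J_def jacobian_def frechet_derivative_at[OF D, symmetric]
      matrix_vector_mult_def matrix_def axis_def
    using z by (simp add: vec_eq_iff forall_3 sum_3 h_def divide_simps power2_eq_square)
  \<comment> \<open>\<open>matrix_inv\<close> is defined by choice, so its inverse property must
    come from the nonzero determinant.\<close>
  moreover have "matrix_inv J ** J = mat 1"
  proof -
    have "invertible J" using z by (simp add: invertible_det_nz det)
    then show ?thesis unfolding invertible_def matrix_inv_def by (rule someI2_ex) blast
  qed
  ultimately have "matrix_inv J *v w = h"
    by (metis matrix_vector_mul_assoc matrix_vector_mul_lid)
  then show ?thesis using assms z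
    by (simp add: pullback2_def det J_def[symmetric] w_def[symmetric] h_def
        vec_eq_iff forall_3 divide_simps power2_eq_square power3_eq_cube power4_eq_xxxx)
qed

section \<open>Decomposition of the pulled-back field and its face conditions\<close>

lemma U2_baseI:
  assumes "u1 \<in> Q3 (int k) (int k - 1) (int k - 2)" "u2 \<in> Q3 (int k - 1) (int k) (int k - 2)"
    "u3 \<in> Q3 (int k - 1) (int k - 1) (int k - 1)"
  shows "(\<lambda>x y z. vector [u1 x y z / (1 + z) ^ (k + 2), u2 x y z / (1 + z) ^ (k + 2),
    u3 x y z / (1 + z) ^ (k + 2)]) \<in> U2_base k"
proof -
  have w: "u \<in> Q3 l m n \<Longrightarrow> (\<lambda>x y z. u x y z / (1 + z) ^ (k + 2)) \<in> Q3w l m n (k + 2)" for u l m n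
    unfolding Q3w_def by blast
  show ?thesis
    unfolding U2_base_def mem_Collect_eq
    by (rule exI[of _ "\<lambda>x y z. u1 x y z / (1 + z) ^ (k + 2)"],
        rule exI[of _ "\<lambda>x y z. u2 x y z / (1 + z) ^ (k + 2)"],
        rule exI[of _ "\<lambda>x y z. u3 x y z / (1 + z) ^ (k + 2)"])
       (intro conjI refl w assms)
qed

theorem lemma8p2:
  fixes k :: nat and v :: "real^3 \<Rightarrow> real^3"
  assumes "k \<ge> 1"
    and "\<forall>i. \<exists>f\<in>P3 (int k - 1). \<forall>q\<in>Pyr. v q $ i = f (q$1) (q$2) (q$3)"
  shows "restrict v (Pyr - {apex}) \<in> U2 k"
proof -
  obtain n where k: "k = Suc n" using assms(1) by (cases k) auto
  then have int_k: "int k - 1 = int n" by simp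
  \<comment> \<open>It suffices that \<open>u\<close> lies in \<open>U2_inf k\<close>, since the
    pullback is injective on fields extensional off the apex.\<close>
  define u where "u = pullback2 Pyr_inf phi (restrict v (Pyr - {apex}))"
  have "\<exists>p\<in>P3 (int n). \<forall>a\<in>Pyr_inf. v (phi a) $ i = p (a$1) (a$2) (a$3) / (1 + a$3) ^ n" for i
  proof -
    obtain f where f: "f \<in> P3 (int n)" "\<And>q. q \<in> Pyr \<Longrightarrow> v q $ i = f (q$1) (q$2) (q$3)"
      using assms(2)[unfolded k, THEN spec[of _ i]] by auto
    obtain p where p: "p \<in> P3 (int n)" "\<And>x y z. 1 + z \<noteq> 0 \<Longrightarrow>
        f (x / (1 + z)) (y / (1 + z)) (z / (1 + z)) = p x y z / (1 + z) ^ n"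
      using P3_projective[OF f(1)] by blast
    have "v (phi a) $ i = p (a$1) (a$2) (a$3) / (1 + a$3) ^ n" if "a \<in> Pyr_inf" for a
    proof -
      have "phi a \<in> Pyr" using phi_image that by blast
      moreover have "1 + a$3 \<noteq> 0" using that by (simp add: Pyr_inf_def)
      ultimately show ?thesis by (simp add: f(2) phi_def p(2))
    qed
    with p(1) show ?thesis by blast
  qed
  then obtain p where P3: "\<And>i. p i \<in> P3 (int n)"
    and p: "\<And>i a. a \<in> Pyr_inf \<Longrightarrow> v (phi a) $ i = p i (a$1) (a$2) (a$3) / (1 + a$3) ^ n"
    by metis
  \<comment> \<open>The denominators are powers n + 3 = k + 2 in the first two components and n + 2
    = k + 1 in the third, which is therefore expanded by 1 + z.\<close>
  have u: "u a = vector
      [(p 1 (a$1) (a$2) (a$3) + a$1 * p 3 (a$1) (a$2) (a$3)) / (1 + a$3) ^ (k + 2),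
       (p 2 (a$1) (a$2) (a$3) + a$2 * p 3 (a$1) (a$2) (a$3)) / (1 + a$3) ^ (k + 2),
       (1 + a$3) * p 3 (a$1) (a$2) (a$3) / (1 + a$3) ^ (k + 2)]" if a: "a \<in> Pyr_inf" for a
  proof -
    have "1 + a$3 \<noteq> 0" using a by (simp add: Pyr_inf_def)
    moreover have "phi a \<in> Pyr - {apex}" using phi_image a by blast
    ultimately show ?thesis
      by (simp add: u_def pullback2_phi[OF a] p[OF a] k vec_eq_iff forall_3 divide_simps
          power2_eq_square power3_eq_cube)
  qed
  obtain q1 \<alpha>1 where q1: "\<And>x y z. p 1 x y z = q1 x y z + \<alpha>1 * z ^ n"
    "q1 \<in> Q3 (int n + 1) (int n) (int n - 1)" using P3_split_top_z[OF P3[of 1]] by metis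
  obtain q2 \<alpha>2 where q2: "\<And>x y z. p 2 x y z = q2 x y z + \<alpha>2 * z ^ n"
    "q2 \<in> Q3 (int n) (int n + 1) (int n - 1)" using P3_split_top_z[OF P3[of 2]] by metis
  obtain q3 \<alpha>3 where q3: "\<And>x y z. p 3 x y z = q3 x y z + \<alpha>3 * z ^ n"
    "q3 \<in> Q3 (int n + 1) (int n) (int n - 1)" "q3 \<in> Q3 (int n) (int n + 1) (int n - 1)"
    "(\<lambda>x y z. x * q3 x y z) \<in> Q3 (int n + 1) (int n) (int n - 1)"
    "(\<lambda>x y z. y * q3 x y z) \<in> Q3 (int n) (int n + 1) (int n - 1)"
    "(\<lambda>x y z. (1 + z) * q3 x y z) \<in> Q3 (int n) (int n) (int n)"
    by (rule P3_split_top_z[OF P3[of 3]]) (rule that)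
  \<comment> \<open>\<open>f\<close> keeps everything free of the three top terms in
    \<open>z ^ n\<close>; those are left to \<open>g\<close> and \<open>h\<close>.\<close>
  define f :: "real \<Rightarrow> real \<Rightarrow> real \<Rightarrow> real^3" where "f = (\<lambda>x y z. vector
      [(q1 x y z + x * q3 x y z) / (1 + z) ^ (k + 2),
       (q2 x y z + y * q3 x y z) / (1 + z) ^ (k + 2),
       (1 + z) * q3 x y z / (1 + z) ^ (k + 2)])"
  define s t :: "real \<Rightarrow> real \<Rightarrow> real"
    where "s = (\<lambda>x y. (\<alpha>2 + \<alpha>3 * y) / 2)" and "t = (\<lambda>x y. (\<alpha>1 + \<alpha>3 * x) / 2)"
  define g :: "real \<Rightarrow> real \<Rightarrow> real \<Rightarrow> real^3" where "g = (\<lambda>x y z. (z^(k - 1) / (1 + z)^(k + 2)) *\<^sub>R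
      vector [0, 2 * s x y, deriv (\<lambda>y'. s x y') y * (1 + z)])"
  define h :: "real \<Rightarrow> real \<Rightarrow> real \<Rightarrow> real^3" where "h = (\<lambda>x y z. (z^(k - 1) / (1 + z)^(k + 2)) *\<^sub>R
      vector [2 * t x y, 0, deriv (\<lambda>x'. t x' y) x * (1 + z)])"
  have "(\<lambda>x y z. q1 x y z + x * q3 x y z) \<in> Q3 (int k) (int k - 1) (int k - 2)"
    "(\<lambda>x y z. q2 x y z + y * q3 x y z) \<in> Q3 (int k - 1) (int k) (int k - 2)"
    "(\<lambda>x y z. (1 + z) * q3 x y z) \<in> Q3 (int k - 1) (int k - 1) (int k - 1)"
    using Q3_add[OF q1(2) q3(4)] Q3_add[OF q2(2) q3(5)] q3(6) by (simp_all add: k add.commute)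
  from U2_baseI[OF this] have f: "f \<in> U2_base k" unfolding f_def .
  \<comment> \<open>\<open>s\<close> is constant in x and affine in y, so it fits because k \<ge> 1;
    likewise \<open>t\<close> with the roles exchanged.\<close>
  have "s \<in> Q2 (int k - 1) (int k)"
    by (rule Q2_sumI[where S = "{0, 1}" and a = "\<lambda>i. 0" and b = "\<lambda>i. i"
          and c = "\<lambda>i. if i = 0 then \<alpha>2 / 2 else \<alpha>3 / 2"]) (auto simp: s_def k field_simps)
  then have g: "g \<in> U2_s k" unfolding U2_s_def g_def by blast
  have "t \<in> Q2 (int k) (int k - 1)"
    by (rule Q2_sumI[where S = "{0, 1}" and a = "\<lambda>i. i" and b = "\<lambda>i. 0"
          and c = "\<lambda>i. if i = 0 then \<alpha>1 / 2 else \<alpha>3 / 2"]) (auto simp: t_def k field_simps)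
  then have h: "h \<in> U2_t k" unfolding U2_t_def h_def by blast
  have ds: "deriv (\<lambda>y'. s x y') y = \<alpha>3 / 2" for x y
    unfolding s_def by (rule DERIV_imp_deriv) (auto intro!: derivative_eq_intros)
  have dt: "deriv (\<lambda>x'. t x' y) x = \<alpha>3 / 2" for x y
    unfolding t_def by (rule DERIV_imp_deriv) (auto intro!: derivative_eq_intros)
  have "\<forall>a\<in>Pyr_inf. u a = f (a$1) (a$2) (a$3) + g (a$1) (a$2) (a$3) + h (a$1) (a$2) (a$3)"
  proof
    fix a assume a: "a \<in> Pyr_inf"
    \<comment> \<open>Naming the denominator lets it be cleared as a single nonzero atom.\<close>
    define W where "W = (1 + a$3) ^ (k + 2)"
    have "W \<noteq> 0" "k - 1 = n" using a by (simp_all add: W_def Pyr_inf_def k)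
    then show "u a = f (a$1) (a$2) (a$3) + g (a$1) (a$2) (a$3) + h (a$1) (a$2) (a$3)"
      unfolding u[OF a] f_def g_def h_def ds dt W_def[symmetric]
      by (simp add: vec_eq_iff forall_3 q1(1) q2(1) q3(1) s_def t_def field_simps)
  qed
  \<comment> \<open>The face conditions use the unsplit formula for \<open>u\<close>: on y = j the
    factor y, which could raise the total degree, becomes the constant j. The faces x = j are
    treated in the same way.\<close>
  moreover have "\<forall>j\<in>{0, 1}. \<exists>r\<in>P2w (int k - 1) (k + 2). \<forall>x\<in>{0..1}. \<forall>z\<ge>0.
      u (vector [x, j, z]) $ 2 = r x z"
  proof
    fix j :: real assume j: "j \<in> {0, 1}"
    \<comment> \<open>The factor 1 gives both summands the form treated by
      \<open>P3_slices\<close>.\<close>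
    let ?r = "\<lambda>x z. (1 * p 2 x j z + j * p 3 x j z) / (1 + z) ^ (k + 2)"
    have "(\<lambda>x z. 1 * p 2 x j z + j * p 3 x j z) \<in> P2 (int k - 1)"
      unfolding int_k by (intro P2_add P3_slices P3)
    from P2wI[OF this] have r: "?r \<in> P2w (int k - 1) (k + 2)" .
    have u_eq: "u (vector [x, j, z]) $ 2 = ?r x z" if "x \<in> {0..1}" "z \<ge> 0" for x z
      using that j by (subst u) (auto simp: Pyr_inf_def)
    show "\<exists>r\<in>P2w (int k - 1) (k + 2). \<forall>x\<in>{0..1}. \<forall>z\<ge>0. u (vector [x, j, z]) $ 2 = r x z"
      by (intro bexI[OF _ r] ballI allI impI u_eq)
  qed
  moreover have "\<forall>j\<in>{0, 1}. \<exists>r\<in>P2w (int k - 1) (k + 2). \<forall>y\<in>{0..1}. \<forall>z\<ge>0.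
      u (vector [j, y, z]) $ 1 = r y z"
  proof
    fix j :: real assume j: "j \<in> {0, 1}"
    let ?r = "\<lambda>y z. (1 * p 1 j y z + j * p 3 j y z) / (1 + z) ^ (k + 2)"
    have "(\<lambda>y z. 1 * p 1 j y z + j * p 3 j y z) \<in> P2 (int k - 1)"
      unfolding int_k by (intro P2_add P3_slices P3)
    from P2wI[OF this] have r: "?r \<in> P2w (int k - 1) (k + 2)" .
    have u_eq: "u (vector [j, y, z]) $ 1 = ?r y z" if "y \<in> {0..1}" "z \<ge> 0" for y z
      using that j by (subst u) (auto simp: Pyr_inf_def)
    show "\<exists>r\<in>P2w (int k - 1) (k + 2). \<forall>y\<in>{0..1}. \<forall>z\<ge>0. u (vector [j, y, z]) $ 1 = r y z"
      by (intro bexI[OF _ r] ballI allI impI u_eq)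
  qed
  moreover have "u \<in> extensional Pyr_inf" by (simp add: u_def pullback2_def)
  ultimately have "u \<in> U2_inf k" using f g h unfolding U2_inf_def by blast
  \<comment> \<open>Bijectivity makes \<open>inv_into\<close> undo the pullback, so the restricted
    field is the image of \<open>u\<close> under the map defining \<open>U2\<close>.\<close>
  moreover have "inv_into (extensional (Pyr - {apex})) (pullback2 Pyr_inf phi) u =
      restrict v (Pyr - {apex})"
    unfolding u_def by (rule bij_betw_inv_into_left[OF pullback2_phi_bij]) simp
  ultimately show ?thesis unfolding U2_def by (metis imageI)
qed

end
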